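(* For all positive integers $s,t$ there is a positive integer $C_{s,t}$ such that the following holds for all positive reals $a,b$ and every positive integer $r$. Let $Q$ be the Cartesian product of a regular $(s-1)$-simplex with side length $a$ and a regular $(t-1)$-simplex with side length $b$. Then every coloring of $\mathbb{E}^{C_{s,t}r}$ with $r$ colors contains a rainbow configuration congruent to $Q$ or a monochromatic configuration congruent to $Q$.
   Context: $\mathbb{E}^d$ denotes $d$-dimensional Euclidean space; an $r$-coloring assigns one of $r$ colors to each point. A configuration (finite point set) is monochromatic if all its points have the same color and rainbow if all its points have pairwise distinct colors. For $K_1\subset\mathbb{E}^{n_1}$, $K_2\subset\mathbb{E}^{n_2}$, the Cartesian product is $K_1\ast K_2=\{(x_1,\dots,x_{n_1},y_1,\dots,y_{n_2}) : (x_i)\in K_1,(y_j)\in K_2\}\subset\mathbb{E}^{n_1+n_2}$; a regular $k$-simplex here means its $k+1$ vertices. *)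

theory Defs
  imports "Jordan_Normal_Form.Matrix"
begin

text \<open>Points of $d$-dimensional Euclidean space are the elements of \<^term>\<open>carrier_vec d :: real vec set\<close>;
  the dimension has to be a term because the theorem quantifies over it.\<close>

definition edist :: "real vec \<Rightarrow> real vec \<Rightarrow> real" where
  "edist x y = sqrt ((x - y) \<bullet> (x - y))"

definition cart_prod :: "real vec set \<Rightarrow> real vec set \<Rightarrow> real vec set" where
  "cart_prod K L = {x @\<^sub>v y | x y. x \<in> K \<and> y \<in> L}"

text \<open>The vertex set of a regular \<open>k\<close>-simplex with side length \<open>a\<close> in dimension \<open>n\<close>.
  Affine independence of the vertices follows from the equal distances when \<open>a > 0\<close>.\<close>

definition regular_simplex :: "nat \<Rightarrow> nat \<Rightarrow> real \<Rightarrow> real vec set \<Rightarrow> bool" where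
  "regular_simplex n k a K \<longleftrightarrow>
     K \<subseteq> carrier_vec n \<and> finite K \<and> card K = k + 1 \<and>
     (\<forall>x\<in>K. \<forall>y\<in>K. x \<noteq> y \<longrightarrow> edist x y = a)"

text \<open>The two configurations may lie in Euclidean spaces of different dimensions.\<close>

definition congruent_configs :: "real vec set \<Rightarrow> real vec set \<Rightarrow> bool" where
  "congruent_configs P Q \<longleftrightarrow>
     (\<exists>f. bij_betw f P Q \<and> (\<forall>x\<in>P. \<forall>y\<in>P. edist (f x) (f y) = edist x y))"

definition monochromatic :: "(real vec \<Rightarrow> nat) \<Rightarrow> real vec set \<Rightarrow> bool" where
  "monochromatic c P \<longleftrightarrow> (\<forall>x\<in>P. \<forall>y\<in>P. c x = c y)"

definition rainbow :: "(real vec \<Rightarrow> nat) \<Rightarrow> real vec set \<Rightarrow> bool" where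
  "rainbow c P \<longleftrightarrow> (\<forall>x\<in>P. \<forall>y\<in>P. x \<noteq> y \<longrightarrow> c x \<noteq> c y)"

end

theory Submission
  imports Defs
begin

text \<open>
  Scaled unit vectors embed the product of two regular simplices with \<open>n\<close> vertices each, an
  \<open>n \<times> n\<close> grid, into dimension \<open>2 n\<close>; all \<open>s \<times> t\<close> subgrids are congruent to the wanted
  configuration, so it suffices to find a rainbow or monochromatic subgrid when \<open>n = D r\<close>.
  Call a row heavy if one colour fills more than a fraction \<open>1/q\<close> of it. If more than \<open>m r\<close> rows are
  heavy, then \<open>m\<close> of them share the filling colour, and double counting gives a monochromatic
  subgrid in these rows; likewise for columns. Otherwise at least half of the rows and half of the
  columns are light, and in the grid they span a rainbow subgrid can be chosen greedily.
\<close>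

section \<open>Counting tools and complete subgrids of dense relations\<close>

lemma pigeonhole_large_fibre:
  fixes t :: nat
  assumes "finite X" "finite Y" "f ` X \<subseteq> Y" "t * card Y < card X"
  obtains y where "y \<in> Y" "t < card {x \<in> X. f x = y}"
proof (rule ccontr)
  assume "\<not> thesis"
  with that have small: "\<And>y. y \<in> Y \<Longrightarrow> card {x \<in> X. f x = y} \<le> t"
    by (meson not_less)
  have "X = (\<Union>y\<in>Y. {x \<in> X. f x = y})"
    using assms(3) by auto
  then have "card X \<le> (\<Sum>y\<in>Y. card {x \<in> X. f x = y})"
    using card_UN_le[OF assms(2), of "\<lambda>y. {x \<in> X. f x = y}"] by simp
  also have "\<dots> \<le> (\<Sum>y\<in>Y. t)"
    by (intro sum_mono small)
  finally show False
    using assms(4) by (simp add: mult.commute)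
qed

lemma sum_card_swap:
  assumes "finite A" "finite B"
  shows "(\<Sum>i\<in>A. card {j \<in> B. E i j}) = (\<Sum>j\<in>B. card {i \<in> A. E i j})"
  using sum_multicount_gen[OF assms, of E "\<lambda>j. card {i \<in> A. E i j}"] by simp

text \<open>A Kovari-Sos-Turan count. With density \<open>1/q\<close> the average column meets at
  least \<open>2 * s\<close> of the rows, so at least a fraction \<open>1/(2q)\<close> of the
  columns meets \<open>s\<close> of them. Each such column picks an \<open>s\<close>-subset of
  \<open>A\<close>, and some \<open>t\<close> columns pick the same one. As \<open>card A\<close> is
  fixed, \<open>card B\<close> has to beat only a constant.\<close>

lemma dense_rows_contain_complete_subgrid:
  assumes fin: "finite A" "finite B" and s: "0 < s" and q: "0 < q"
    and cardA: "card A = 2 * s * q"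
    and dense: "\<And>i. i \<in> A \<Longrightarrow> card B \<le> q * card {j \<in> B. E i j}"
    and cardB: "2 * q * (t * 2 ^ (2 * s * q)) < card B"
  obtains R S where "R \<subseteq> A" "S \<subseteq> B" "card R = s" "card S = t" "\<And>i j. i \<in> R \<Longrightarrow> j \<in> S \<Longrightarrow> E i j"
proof -
  define X where "X = {j \<in> B. s \<le> card {i \<in> A. E i j}}"
  have XB: "X \<subseteq> B" and finX: "finite X"
    using fin by (auto simp: X_def)
  have "card A * card B \<le> (\<Sum>i\<in>A. q * card {j \<in> B. E i j})"
    using sum_mono[of A "\<lambda>_. card B", OF dense] by simp
  also have "\<dots> = q * (\<Sum>j\<in>B. card {i \<in> A. E i j})"
    by (simp add: sum_card_swap[OF fin] flip: sum_distrib_left)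
  also have "(\<Sum>j\<in>B. card {i \<in> A. E i j}) \<le> (\<Sum>j\<in>B. (if j \<in> X then card A else 0) + s)"
  proof (rule sum_mono)
    fix j assume "j \<in> B"
    then show "card {i \<in> A. E i j} \<le> (if j \<in> X then card A else 0) + s"
      using card_mono[of A "{i \<in> A. E i j}"] fin by (auto simp: X_def)
  qed
  also have "\<dots> = card X * card A + card B * s"
    using fin XB by (simp add: sum.distrib sum.If_cases Int_absorb1)
  \<comment> \<open>The density yields \<open>2 * s * card B\<close> incidences; columns outside
    \<open>X\<close> hold at most \<open>s * card B\<close> of them, so at least half lies in
    \<open>X\<close>.\<close>
  finally have "(s * q) * (2 * card B) \<le> (s * q) * (2 * q * card X + card B)"
    using cardA by (simp add: algebra_simps)
  then have "card B \<le> 2 * q * card X"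
    using s q by simp
  with cardB have "2 * q * (t * 2 ^ (2 * s * q)) < 2 * q * card X"
    by linarith
  \<comment> \<open>The pigeonholes are all subsets of \<open>A\<close>, a crude bound for the
    number of its \<open>s\<close>-subsets; this is the factor
    \<open>2 ^ (2 * s * q)\<close>.\<close>
  then have big: "t * card (Pow A) < card X"
    using fin cardA by (simp add: card_Pow)
  have "\<exists>R. R \<subseteq> {i \<in> A. E i j} \<and> card R = s" if "j \<in> X" for j
    using that obtain_subset_with_card_n[of s "{i \<in> A. E i j}"] unfolding X_def by blast
  then obtain g where g: "\<And>j. j \<in> X \<Longrightarrow> g j \<subseteq> {i \<in> A. E i j} \<and> card (g j) = s"
    by metis
  then have "g ` X \<subseteq> Pow A"
    by blast
  then obtain R where R: "R \<in> Pow A" "t < card {j \<in> X. g j = R}"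
    using pigeonhole_large_fibre[OF finX _ _ big] fin by blast
  then obtain S where S: "S \<subseteq> {j \<in> X. g j = R}" "card S = t"
    using obtain_subset_with_card_n[of t "{j \<in> X. g j = R}"] by auto
  have "card R = s"
  proof -
    have "{j \<in> X. g j = R} \<noteq> {}"
      using R(2) by (metis card.empty not_less0)
    then show ?thesis
      using g by blast
  qed
  then show thesis
    using that[of R S] R S XB g by blast
qed

section \<open>Greedy choice of rainbow subgrids\<close>

text \<open>Rows are added one at a time, each at the cost of at most half of the surviving columns.
  After \<open>u < s\<close> rows, lightness leaves in each column at most \<open>u * n / q\<close>
  rows repeating a chosen colour. This is below \<open>card A / 2\<close>, because
  \<open>n \<le> 2 * card A\<close> and \<open>4 * u < q\<close>, so by averaging some row repeats
  in at most half of the columns. Colours are compared only within a column here.\<close>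

lemma rows_with_many_rainbow_columns:
  fixes f :: "'a \<Rightarrow> 'b \<Rightarrow> 'c"
  assumes fin: "finite A" "finite B" and n: "0 < n" "n \<le> 2 * card A" "n \<le> 2 * card B"
    and light: "\<And>j k. j \<in> B \<Longrightarrow> q * card {i \<in> A. f i j = k} \<le> n"
    and q: "4 * s \<le> q" and "u \<le> s"
  shows "\<exists>R J. R \<subseteq> A \<and> J \<subseteq> B \<and> card R = u \<and> card B \<le> 2 ^ u * card J \<and>
    (\<forall>j\<in>J. inj_on (\<lambda>i. f i j) R)"
  using \<open>u \<le> s\<close>
proof (induction u)
  case 0
  then show ?case
    by (intro exI[of _ "{}"] exI[of _ B]) auto
next
  case (Suc u)
  then obtain R J where RJ: "R \<subseteq> A" "J \<subseteq> B" "card R = u" "card B \<le> 2 ^ u * card J"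
    "\<And>j. j \<in> J \<Longrightarrow> inj_on (\<lambda>i. f i j) R"
    by auto
  have finR: "finite R" and finJ: "finite J"
    using RJ fin finite_subset by blast+
  have cpos: "0 < card J" "0 < card A"
    using RJ(4) n by (auto intro: ccontr)
  define bad where "bad i = {j \<in> J. f i j \<in> (\<lambda>i'. f i' j) ` R}" for i
  have "q * card {i \<in> A. f i j \<in> (\<lambda>i'. f i' j) ` R} \<le> u * n" if "j \<in> J" for j
  proof -
    have "{i \<in> A. f i j \<in> (\<lambda>i'. f i' j) ` R} = (\<Union>i'\<in>R. {i \<in> A. f i j = f i' j})"
      by auto
    then have "q * card {i \<in> A. f i j \<in> (\<lambda>i'. f i' j) ` R} \<le> q * (\<Sum>i'\<in>R. card {i \<in> A. f i j = f i' j})"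
      using card_UN_le[OF finR, of "\<lambda>i'. {i \<in> A. f i j = f i' j}"] by simp
    also have "\<dots> \<le> (\<Sum>i'\<in>R. n)"
      unfolding sum_distrib_left using light that RJ(2) by (intro sum_mono) auto
    finally show ?thesis
      using RJ(3) by simp
  qed
  then have "q * (\<Sum>j\<in>J. card {i \<in> A. f i j \<in> (\<lambda>i'. f i' j) ` R}) \<le> (\<Sum>j\<in>J. u * n)"
    unfolding sum_distrib_left by (rule sum_mono)
  then have total: "q * (\<Sum>i\<in>A. card (bad i)) \<le> card J * (u * n)"
    unfolding bad_def sum_card_swap[OF fin(1) finJ] by simp
  have "\<exists>i\<in>A. 2 * card (bad i) \<le> card J"
  proof (rule ccontr)
    assume "\<not> ?thesis"
    then have "(\<Sum>i\<in>A. card J) \<le> (\<Sum>i\<in>A. 2 * card (bad i))"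
      by (intro sum_mono) (auto simp: not_le intro: less_imp_le)
    then have "card A * card J \<le> 2 * (\<Sum>i\<in>A. card (bad i))"
      by (simp flip: sum_distrib_left)
    then have "q * (card A * card J) \<le> q * (2 * (\<Sum>i\<in>A. card (bad i)))"
      by (rule mult_le_mono2)
    also have "\<dots> \<le> 2 * (card J * (u * n))"
      using total by simp
    also have "\<dots> \<le> 2 * (card J * (u * (2 * card A)))"
      using n by simp
    finally have "q * (card A * card J) \<le> (4 * u) * (card A * card J)"
      by (simp add: ac_simps)
    then show False
      using cpos q Suc.prems by simp
  qed
  then obtain i where i: "i \<in> A" "2 * card (bad i) \<le> card J"
    by blast
  \<comment> \<open>A row of \<open>R\<close> repeats its own colour in every column, so it would be
    bad on all of the nonempty \<open>J\<close>.\<close>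
  have "i \<notin> R"
  proof
    assume "i \<in> R"
    then have "bad i = J"
      by (auto simp: bad_def)
    with i cpos show False
      by simp
  qed
  have "bad i \<subseteq> J"
    by (auto simp: bad_def)
  then have "card J \<le> 2 * card (J - bad i)"
    using i(2) finJ by (simp add: card_Diff_subset finite_subset)
  then have "card B \<le> 2 ^ u * (2 * card (J - bad i))"
    using RJ(4) by (meson le_trans mult_le_mono2)
  then have "card B \<le> 2 ^ Suc u * card (J - bad i)"
    by (simp add: ac_simps)
  moreover have "inj_on (\<lambda>i. f i j) (insert i R)" if "j \<in> J - bad i" for j
    using that RJ(5) by (auto simp: bad_def inj_on_insert)
  ultimately show ?case
    using RJ i \<open>i \<notin> R\<close> finR
    by (intro exI[of _ "insert i R"] exI[of _ "J - bad i"]) auto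
qed

text \<open>Columns are added one at a time. At most \<open>s * t\<close> colours are in use, and
  each of the \<open>s\<close> rows shows a given colour in at most \<open>n / q\<close> columns, so
  fewer than \<open>card J\<close> columns repeat a used colour. Inside the new column the colours
  differ by \<open>inj\<close>.\<close>

lemma extend_rainbow_columns:
  fixes f :: "'a \<Rightarrow> 'b \<Rightarrow> 'c"
  assumes fin: "finite R" "finite J" and R: "card R = s" "0 < s"
    and inj: "\<And>j. j \<in> J \<Longrightarrow> inj_on (\<lambda>i. f i j) R"
    and light: "\<And>i k. i \<in> R \<Longrightarrow> q * card {j \<in> J. f i j = k} \<le> n"
    and large: "s * s * t * n < q * card J" and "v \<le> t"
  shows "\<exists>S. S \<subseteq> J \<and> card S = v \<and> inj_on (\<lambda>(i, j). f i j) (R \<times> S)"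
  using \<open>v \<le> t\<close>
proof (induction v)
  case 0
  then show ?case
    by (intro exI[of _ "{}"]) auto
next
  case (Suc v)
  then obtain S where S: "S \<subseteq> J" "card S = v" "inj_on (\<lambda>(i, j). f i j) (R \<times> S)"
    by auto
  have finS: "finite S"
    using S(1) fin(2) finite_subset by blast
  define F where "F = (\<lambda>(i, j). f i j) ` (R \<times> S)"
  have finF: "finite F"
    using fin finS by (simp add: F_def)
  have cardF: "card F \<le> s * v"
    unfolding F_def using card_image_le[of "R \<times> S" "\<lambda>(i, j). f i j"] fin finS R S
    by (simp add: card_cartesian_product)
  define blocked where "blocked = (\<Union>(i, k)\<in>R \<times> F. {j \<in> J. f i j = k})"
  have "q * card blocked \<le> q * (\<Sum>(i, k)\<in>R \<times> F. card {j \<in> J. f i j = k})"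
    using card_UN_le[of "R \<times> F" "\<lambda>(i, k). {j \<in> J. f i j = k}"] fin finF
    by (simp add: blocked_def case_prod_unfold)
  also have "\<dots> \<le> (\<Sum>(i, k)\<in>R \<times> F. n)"
    unfolding sum_distrib_left using light by (intro sum_mono) auto
  also have "\<dots> = s * card F * n"
    using R by (simp add: case_prod_unfold card_cartesian_product)
  also have "\<dots> \<le> s * (s * t) * n"
    using cardF Suc.prems by (intro mult_le_mono le_refl) (meson Suc_leD le_trans mult_le_mono2)
  also have "\<dots> < q * card J"
    using large by (simp add: ac_simps)
  finally have "card blocked < card J"
    by simp
  moreover have "finite blocked"
    using fin by (auto simp: blocked_def intro: finite_subset)
  ultimately obtain j where j: "j \<in> J" "j \<notin> blocked"
    using card_mono[of blocked J] by (meson not_le subsetI)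
  have new: "f i j \<notin> F" if "i \<in> R" for i
    using j that by (auto simp: blocked_def)
  \<comment> \<open>Any row of \<open>R\<close> witnesses that a column already in \<open>S\<close>
    shows a colour of \<open>F\<close>; hence the new column lies outside \<open>S\<close>.\<close>
  obtain i where "i \<in> R"
    using R by fastforce
  then have "j \<notin> S"
    using new by (force simp: F_def)
  have "inj_on (\<lambda>(i, j). f i j) (R \<times> insert j S)"
  proof (rule inj_onI, clarify)
    fix i1 j1 i2 j2
    assume *: "i1 \<in> R" "j1 \<in> insert j S" "i2 \<in> R" "j2 \<in> insert j S" "f i1 j1 = f i2 j2"
    have inF: "f i' j' \<in> F" if "i' \<in> R" "j' \<in> S" for i' j'
      using that by (force simp: F_def)
    \<comment> \<open>An old and a new column cannot share a colour: the old one shows colours of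
      \<open>F\<close>, the new one none.\<close>
    consider "j1 \<in> S" "j2 \<in> S" | "j1 = j" "j2 = j"
      using * new inF by (metis insert_iff)
    then show "i1 = i2 \<and> j1 = j2"
    proof cases
      case 1
      then show ?thesis
        using inj_onD[OF S(3), of "(i1, j1)" "(i2, j2)"] * by simp
    next
      case 2
      then show ?thesis
        using inj_onD[OF inj[OF j(1)], of i1 i2] * by simp
    qed
  qed
  then show ?case
    using S j \<open>j \<notin> S\<close> finS by (intro exI[of _ "insert j S"]) auto
qed

text \<open>The greedy row choice keeps at least \<open>n / 2 ^ Suc s\<close> columns, and the
  second bound on \<open>q\<close> is what the greedy column choice then requires. Here
  \<open>n\<close> is the side of a surrounding grid of which \<open>A\<close> and \<open>B\<close>
  retain at least half.\<close>

lemma light_grid_contains_rainbow_subgrid: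
  fixes f :: "'a \<Rightarrow> 'b \<Rightarrow> 'c"
  assumes fin: "finite A" "finite B" and n: "0 < n" "n \<le> 2 * card A" "n \<le> 2 * card B"
    and rows: "\<And>i k. i \<in> A \<Longrightarrow> q * card {j \<in> B. f i j = k} \<le> n"
    and cols: "\<And>j k. j \<in> B \<Longrightarrow> q * card {i \<in> A. f i j = k} \<le> n"
    and q: "4 * s \<le> q" "s * s * t * 2 ^ Suc s < q" and s: "0 < s"
  obtains R S where "R \<subseteq> A" "S \<subseteq> B" "card R = s" "card S = t" "inj_on (\<lambda>(i, j). f i j) (R \<times> S)"
proof -
  obtain R J where RJ: "R \<subseteq> A" "J \<subseteq> B" "card R = s" "card B \<le> 2 ^ s * card J"
    "\<And>j. j \<in> J \<Longrightarrow> inj_on (\<lambda>i. f i j) R"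
    using rows_with_many_rainbow_columns[where f = f, OF fin n cols q(1) le_refl] by auto
  have finRJ: "finite R" "finite J"
    using RJ fin finite_subset by blast+
  have nJ: "n \<le> 2 ^ Suc s * card J"
    using n(3) RJ(4) by simp
  then have "0 < card J"
    using n(1) by (auto intro: ccontr)
  have "s * s * t * n \<le> s * s * t * (2 ^ Suc s * card J)"
    using nJ by (rule mult_le_mono2)
  also have "\<dots> < q * card J"
    using q(2) \<open>0 < card J\<close> by (simp only: mult.assoc[symmetric] mult_less_mono1)
  finally have large: "s * s * t * n < q * card J" .
  have "q * card {j \<in> J. f i j = k} \<le> n" if "i \<in> R" for i k
  proof -
    have "card {j \<in> J. f i j = k} \<le> card {j \<in> B. f i j = k}"
      using RJ(2) fin by (intro card_mono) auto
    then show ?thesis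
      using rows[of i k] that RJ(1) by (meson le_trans mult_le_mono2 subsetD)
  qed
  then obtain S where "S \<subseteq> J" "card S = t" "inj_on (\<lambda>(i, j). f i j) (R \<times> S)"
    using extend_rainbow_columns[where f = f, OF finRJ RJ(3) s RJ(5) _ large le_refl] by auto
  then show thesis
    using that RJ by blast
qed

section \<open>Heavy rows and the dichotomy for coloured grids\<close>

text \<open>By pigeonhole over the \<open>r\<close> colours, \<open>2 * s * q\<close> heavy rows
  share their filling colour \<open>k\<close>, and on these rows the relation
  \<open>f i j = k\<close> has density at least \<open>1/q\<close>. The number of colours enters
  only through \<open>cardA\<close>, which keeps the final bound linear in \<open>r\<close>.\<close>

lemma heavy_rows_contain_monochromatic_subgrid:
  fixes f :: "'a \<Rightarrow> 'b \<Rightarrow> nat"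
  assumes fin: "finite A" "finite B" and s: "0 < s" and q: "0 < q"
    and col: "\<And>i j. i \<in> A \<Longrightarrow> j \<in> B \<Longrightarrow> f i j < r"
    and heavy: "\<And>i. i \<in> A \<Longrightarrow> \<exists>k. card B < q * card {j \<in> B. f i j = k}"
    and cardA: "2 * s * q * r < card A"
    and cardB: "2 * q * (t * 2 ^ (2 * s * q)) < card B"
  shows "\<exists>R S k. R \<subseteq> A \<and> S \<subseteq> B \<and> card R = s \<and> card S = t \<and> (\<forall>i\<in>R. \<forall>j\<in>S. f i j = k)"
proof -
  obtain h where h: "\<And>i. i \<in> A \<Longrightarrow> card B < q * card {j \<in> B. f i j = h i}"
    using heavy by metis
  have "h i < r" if "i \<in> A" for i
  proof -
    \<comment> \<open>The filling colour really occurs in the row, so it is one of the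
      \<open>r\<close> colours.\<close>
    have "{j \<in> B. f i j = h i} \<noteq> {}"
      using h[OF that] by (metis card.empty mult_0_right not_less0)
    then obtain j where "j \<in> B" "f i j = h i"
      by blast
    then show ?thesis
      using col[of i j] that by simp
  qed
  then have "h ` A \<subseteq> {..<r}"
    by auto
  then obtain k where k: "2 * s * q < card {i \<in> A. h i = k}"
    using pigeonhole_large_fibre[of A "{..<r}" h "2 * s * q"] fin cardA
    by (metis card_lessThan finite_lessThan)
  then obtain A' where A': "A' \<subseteq> {i \<in> A. h i = k}" "card A' = 2 * s * q" "finite A'"
    using obtain_subset_with_card_n[of "2 * s * q" "{i \<in> A. h i = k}"] by auto
  have dense: "card B \<le> q * card {j \<in> B. f i j = k}" if "i \<in> A'" for i
    using h[of i] that A'(1) by auto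
  obtain R S where "R \<subseteq> A'" "S \<subseteq> B" "card R = s" "card S = t" "\<And>i j. i \<in> R \<Longrightarrow> j \<in> S \<Longrightarrow> f i j = k"
    by (rule dense_rows_contain_complete_subgrid
        [where E = "\<lambda>i j. f i j = k", OF A'(3) fin(2) s q A'(2) dense cardB]) blast+
  then show ?thesis
    using A'(1) by (intro exI[of _ R] exI[of _ S] exI[of _ k]) blast
qed

lemma rainbow_or_monochromatic_subgrid:
  assumes "0 < s" "0 < t"
  shows "\<exists>D>0. \<forall>r (f :: nat \<Rightarrow> nat \<Rightarrow> nat).
    0 < r \<longrightarrow> (\<forall>i<D * r. \<forall>j<D * r. f i j < r) \<longrightarrow>
    (\<exists>R S. R \<subseteq> {..<D * r} \<and> S \<subseteq> {..<D * r} \<and> card R = s \<and> card S = t \<and>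
      (inj_on (\<lambda>(i, j). f i j) (R \<times> S) \<or> (\<exists>k. \<forall>i\<in>R. \<forall>j\<in>S. f i j = k)))"
proof -
  define q where "q = 4 * s + s * s * t * 2 ^ Suc s"
  have q: "4 * s \<le> q" "s * s * t * 2 ^ Suc s < q" "0 < q"
    using assms by (auto simp: q_def)
  \<comment> \<open>The first two summands ensure that, when neither heavy case applies, at most
    half of the rows and half of the columns are heavy. The last two supply the constants of the
    monochromatic case for rows and for columns.\<close>
  define D where "D = 4 * s * q + 4 * t * q + 2 * q * (t * 2 ^ (2 * s * q))
    + 2 * q * (s * 2 ^ (2 * t * q))"
  have "0 < D"
    using assms q by (simp add: D_def)
  moreover have "\<exists>R S. R \<subseteq> {..<D * r} \<and> S \<subseteq> {..<D * r} \<and> card R = s \<and> card S = t \<and>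
      (inj_on (\<lambda>(i, j). f i j) (R \<times> S) \<or> (\<exists>k. \<forall>i\<in>R. \<forall>j\<in>S. f i j = k))"
    if r: "0 < r" and col: "\<forall>i<D * r. \<forall>j<D * r. f i j < r"
    for r :: nat and f :: "nat \<Rightarrow> nat \<Rightarrow> nat"
  proof -
    define N where "N = {..<D * r}"
    have N: "finite N" "card N = D * r"
      by (auto simp: N_def)
    have "D * 1 \<le> D * r"
      using r by (intro mult_le_mono2) simp
    moreover have "2 * q * (t * 2 ^ (2 * s * q)) < D" "2 * q * (s * 2 ^ (2 * t * q)) < D"
      using assms q(3) by (simp_all add: D_def)
    ultimately have D: "2 * q * (t * 2 ^ (2 * s * q)) < card N" "2 * q * (s * 2 ^ (2 * t * q)) < card N"
      unfolding N(2) by linarith+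
    have half: "2 * (2 * s * q * r) \<le> card N" "2 * (2 * t * q * r) \<le> card N"
      unfolding N(2) D_def by (simp_all add: algebra_simps)
    define HR where "HR = {i \<in> N. \<exists>k. card N < q * card {j \<in> N. f i j = k}}"
    define HC where "HC = {j \<in> N. \<exists>k. card N < q * card {i \<in> N. f i j = k}}"
    have sub: "HR \<subseteq> N" "HC \<subseteq> N" and fin: "finite HR" "finite HC"
      by (auto simp: HR_def HC_def N(1))
    consider "2 * s * q * r < card HR" | "2 * t * q * r < card HC"
      | "card HR \<le> 2 * s * q * r" "card HC \<le> 2 * t * q * r"
      by linarith
    then show ?thesis
    proof cases
      case 1
      have "\<exists>R S k. R \<subseteq> HR \<and> S \<subseteq> N \<and> card R = s \<and> card S = t \<and> (\<forall>i\<in>R. \<forall>j\<in>S. f i j = k)"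
      proof (rule heavy_rows_contain_monochromatic_subgrid
          [where f = f, OF fin(1) N(1) assms(1) q(3) _ _ 1 D(1)])
        show "f i j < r" if "i \<in> HR" "j \<in> N" for i j
          using that col sub by (auto simp: N_def)
      qed (auto simp: HR_def)
      then obtain R S k where "R \<subseteq> HR" "S \<subseteq> N" "card R = s" "card S = t" "\<forall>i\<in>R. \<forall>j\<in>S. f i j = k"
        by blast
      then show ?thesis
        using sub unfolding N_def by (intro exI[of _ R] exI[of _ S]) blast
    next
      case 2
      have "\<exists>S R k. S \<subseteq> HC \<and> R \<subseteq> N \<and> card S = t \<and> card R = s \<and> (\<forall>j\<in>S. \<forall>i\<in>R. f i j = k)"
      proof (rule heavy_rows_contain_monochromatic_subgrid
          [where f = "\<lambda>j i. f i j", OF fin(2) N(1) assms(2) q(3) _ _ 2 D(2)])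
        show "f i j < r" if "j \<in> HC" "i \<in> N" for j i
          using that col sub by (auto simp: N_def)
      qed (auto simp: HC_def)
      then obtain S R k where "S \<subseteq> HC" "R \<subseteq> N" "card S = t" "card R = s" "\<forall>j\<in>S. \<forall>i\<in>R. f i j = k"
        by blast
      then show ?thesis
        using sub unfolding N_def by (intro exI[of _ R] exI[of _ S]) blast
    next
      case 3
      \<comment> \<open>Lightness stays measured against the full side \<open>card N\<close> after
        heavy lines are deleted, so it survives the deletion.\<close>
      have mono: "q * card {x \<in> N - H. P x} \<le> card N" if "q * card {x \<in> N. P x} \<le> card N" for H P
        using card_mono[of "{x \<in> N. P x}" "{x \<in> N - H. P x}"] N(1) that
        by (force intro: le_trans[OF mult_le_mono2])
      obtain R S where "R \<subseteq> N - HR" "S \<subseteq> N - HC" "card R = s" "card S = t"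
        "inj_on (\<lambda>(i, j). f i j) (R \<times> S)"
      proof (rule light_grid_contains_rainbow_subgrid[where f = f and A = "N - HR" and B = "N - HC"
            and n = "card N", OF _ _ _ _ _ _ _ q(1,2) assms(1)])
        show "card N \<le> 2 * card (N - HR)" "card N \<le> 2 * card (N - HC)"
          using 3 half sub fin by (auto simp: card_Diff_subset)
        show "q * card {j \<in> N - HC. f i j = k} \<le> card N" if "i \<in> N - HR" for i k
          using that by (intro mono) (auto simp: HR_def not_less)
        show "q * card {i \<in> N - HR. f i j = k} \<le> card N" if "j \<in> N - HC" for j k
          using that by (intro mono) (auto simp: HC_def not_less)
      qed (use N \<open>0 < D\<close> r in auto)
      then show ?thesis
        unfolding N_def by blast
    qed
  qed
  ultimately show ?thesis
    by (intro exI[of _ D] conjI allI impI) simp_all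
qed

section \<open>Grid points in Euclidean space and their congruence\<close>

text \<open>Distinct unit vectors are at distance \<open>sqrt 2\<close>, hence the scaling; the two
  blocks are orthogonal.\<close>

definition grid_point :: "real \<Rightarrow> real \<Rightarrow> nat \<Rightarrow> nat \<Rightarrow> nat \<Rightarrow> real vec" where
  "grid_point a b n i j = (a / sqrt 2) \<cdot>\<^sub>v unit_vec n i @\<^sub>v (b / sqrt 2) \<cdot>\<^sub>v unit_vec n j"

lemma grid_point_carrier: "grid_point a b n i j \<in> carrier_vec (n + n)"
  by (simp add: grid_point_def)

lemma edist_append_vec:
  assumes "x \<in> carrier_vec m" "x' \<in> carrier_vec m" "y \<in> carrier_vec n" "y' \<in> carrier_vec n"
  shows "edist (x @\<^sub>v y) (x' @\<^sub>v y') = sqrt ((edist x x')\<^sup>2 + (edist y y')\<^sup>2)"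
proof -
  have "(x @\<^sub>v y) - (x' @\<^sub>v y') = (x - x') @\<^sub>v (y - y')"
    using assms by (intro eq_vecI) auto
  moreover have "0 \<le> v \<bullet> v" for v :: "real vec"
    by (simp add: scalar_prod_def sum_nonneg)
  ultimately show ?thesis
    using assms by (simp add: edist_def scalar_prod_append[of _ m _ n])
qed

lemma edist_scaled_unit_vec:
  assumes "i < n" "i' < n" "0 \<le> a"
  shows "edist ((a / sqrt 2) \<cdot>\<^sub>v unit_vec n i) ((a / sqrt 2) \<cdot>\<^sub>v unit_vec n i') = (if i = i' then 0 else a)"
proof (cases "i = i'")
  case True
  then show ?thesis
    by (simp add: edist_def scalar_prod_def)
next
  case False
  let ?v = "(a / sqrt 2) \<cdot>\<^sub>v unit_vec n i - (a / sqrt 2) \<cdot>\<^sub>v unit_vec n i'"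
  have "?v \<bullet> ?v = (\<Sum>l\<in>{0..<n}. if l = i then a\<^sup>2 / 2 else if l = i' then a\<^sup>2 / 2 else 0)"
    unfolding scalar_prod_def using assms False
    by (auto intro!: sum.cong simp: power2_eq_square)
  also have "\<dots> = (\<Sum>l\<in>{0..<n}. (if l = i then a\<^sup>2 / 2 else 0) + (if l = i' then a\<^sup>2 / 2 else 0))"
    using False by (intro sum.cong) auto
  also have "\<dots> = a\<^sup>2"
    using assms by (simp add: sum.distrib)
  finally show ?thesis
    using assms False by (simp add: edist_def)
qed

lemma edist_grid_point:
  assumes "i < n" "i' < n" "j < n" "j' < n" "0 \<le> a" "0 \<le> b"
  shows "edist (grid_point a b n i j) (grid_point a b n i' j') =
    sqrt ((if i = i' then 0 else a)\<^sup>2 + (if j = j' then 0 else b)\<^sup>2)"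
  using assms by (simp add: grid_point_def edist_append_vec[of _ n _ _ n] edist_scaled_unit_vec)

text \<open>Read off from distances: equal points are at distance 0, and since \<open>a\<close> and
  \<open>b\<close> are positive both squared terms can vanish only for equal indices.\<close>

lemma grid_point_inject:
  assumes "i < n" "i' < n" "j < n" "j' < n" "0 < a" "0 < b"
    and "grid_point a b n i j = grid_point a b n i' j'"
  shows "i = i' \<and> j = j'"
proof -
  have "sqrt ((if i = i' then 0 else a)\<^sup>2 + (if j = j' then 0 else b)\<^sup>2)
      = edist (grid_point a b n i j) (grid_point a b n i j)"
    using edist_grid_point[of i n i' j j' a b] assms by simp
  also have "\<dots> = 0"
    using edist_grid_point[of i n i j j a b] assms by simp
  finally show ?thesis
    using assms(5,6) by (auto split: if_splits simp: sum_power2_eq_zero_iff)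
qed

lemma edist_regular_simplex:
  assumes "regular_simplex n k a K" "x \<in> K" "y \<in> K"
  shows "edist x y = (if x = y then 0 else a)"
  using assms by (auto simp: regular_simplex_def edist_def scalar_prod_def)

text \<open>On both sides a distance depends only on which of the two components agree, so arbitrary
  bijections from \<open>R\<close> to \<open>K\<close> and from \<open>S\<close> to \<open>L\<close>
  induce an isometry.\<close>

lemma subgrid_congruent_cart_prod:
  assumes K: "regular_simplex n\<^sub>1 (s - 1) a K" and L: "regular_simplex n\<^sub>2 (t - 1) b L"
    and pos: "0 < a" "0 < b" "0 < s" "0 < t"
    and R: "R \<subseteq> {..<n}" "card R = s" and S: "S \<subseteq> {..<n}" "card S = t"
  shows "congruent_configs ((\<lambda>(i, j). grid_point a b n i j) ` (R \<times> S)) (cart_prod K L)"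
proof -
  let ?p = "\<lambda>(i, j). grid_point a b n i j"
  have dim: "K \<subseteq> carrier_vec n\<^sub>1" "L \<subseteq> carrier_vec n\<^sub>2"
    using K L by (auto simp: regular_simplex_def)
  have lt: "i < n" "j < n" if "i \<in> R" "j \<in> S" for i j
    using that R S by auto
  have finRS: "finite R" "finite S"
    using R S finite_subset by blast+
  \<comment> \<open>A regular \<open>(s - 1)\<close>-simplex has \<open>s - 1 + 1\<close> vertices,
    which is \<open>s\<close> because \<open>s\<close> is positive.\<close>
  obtain g where g: "bij_betw g R K"
    using finite_same_card_bij[of R K] finRS K R pos by (auto simp: regular_simplex_def)
  obtain h where h: "bij_betw h S L"
    using finite_same_card_bij[of S L] finRS L S pos by (auto simp: regular_simplex_def)
  have gK: "g i \<in> K" if "i \<in> R" for i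
    using g that by (rule bij_betwE[rule_format])
  have hL: "h j \<in> L" if "j \<in> S" for j
    using h that by (rule bij_betwE[rule_format])
  have g_iff: "g i = g i' \<longleftrightarrow> i = i'" if "i \<in> R" "i' \<in> R" for i i'
    using g that by (meson bij_betw_imp_inj_on inj_on_eq_iff)
  have h_iff: "h j = h j' \<longleftrightarrow> j = j'" if "j \<in> S" "j' \<in> S" for j j'
    using h that by (meson bij_betw_imp_inj_on inj_on_eq_iff)
  have inj: "inj_on ?p (R \<times> S)"
  proof (rule inj_onI, clarify)
    fix i j i' j'
    assume "i \<in> R" "j \<in> S" "i' \<in> R" "j' \<in> S" "grid_point a b n i j = grid_point a b n i' j'"
    then show "i = i' \<and> j = j'"
      using grid_point_inject[of i n i' j j' a b] lt pos by simp
  qed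
  \<comment> \<open>A congruence acts on vectors, so the indices are recovered through the inverse
    of the injective grid map.\<close>
  define F where "F x = (case inv_into (R \<times> S) ?p x of (i, j) \<Rightarrow> g i @\<^sub>v h j)" for x
  have F: "F (grid_point a b n i j) = g i @\<^sub>v h j" if "i \<in> R" "j \<in> S" for i j
    using inv_into_f_f[OF inj, of "(i, j)"] that by (simp add: F_def)
  have app_iff: "g i @\<^sub>v h j = g i' @\<^sub>v h j' \<longleftrightarrow> i = i' \<and> j = j'"
    if "i \<in> R" "j \<in> S" "i' \<in> R" "j' \<in> S" for i j i' j'
    using append_vec_eq[of "g i" n\<^sub>1 "g i'"] gK hL dim that g_iff h_iff by blast
  have "inj_on F (?p ` (R \<times> S))"
    by (rule inj_onI) (auto simp: F app_iff)
  moreover have "F ` ?p ` (R \<times> S) = cart_prod K L"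
  proof -
    have "F ` ?p ` (R \<times> S) = {g i @\<^sub>v h j | i j. i \<in> R \<and> j \<in> S}"
      by (force simp: F image_iff)
    also have "\<dots> = cart_prod (g ` R) (h ` S)"
      by (auto simp: cart_prod_def)
    finally show ?thesis
      using g h by (simp add: bij_betw_def)
  qed
  moreover have "edist (F x) (F y) = edist x y" if xy: "x \<in> ?p ` (R \<times> S)" "y \<in> ?p ` (R \<times> S)" for x y
  proof -
    obtain i j i' j' where *: "i \<in> R" "j \<in> S" "i' \<in> R" "j' \<in> S"
      "x = grid_point a b n i j" "y = grid_point a b n i' j'"
      using xy by auto
    have "edist (F x) (F y) = sqrt ((edist (g i) (g i'))\<^sup>2 + (edist (h j) (h j'))\<^sup>2)"
      using * gK hL dim by (simp add: F edist_append_vec[of _ n\<^sub>1 _ _ n\<^sub>2] subset_iff)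
    also have "\<dots> = sqrt ((if i = i' then 0 else a)\<^sup>2 + (if j = j' then 0 else b)\<^sup>2)"
      using * by (simp add: edist_regular_simplex[OF K] edist_regular_simplex[OF L] gK hL g_iff h_iff)
    also have "\<dots> = edist x y"
      using * lt pos by (simp add: edist_grid_point)
    finally show ?thesis .
  qed
  ultimately show ?thesis
    unfolding congruent_configs_def bij_betw_def by blast
qed

section \<open>From coloured grids to colourings of Euclidean space\<close>

theorem theorem4:
  fixes s t :: nat
  assumes "s > 0" and "t > 0"
  shows "\<exists>C::nat. C > 0 \<and>
    (\<forall>(a::real) (b::real) (r::nat) (n\<^sub>1::nat) (n\<^sub>2::nat) K L c.
       a > 0 \<longrightarrow> b > 0 \<longrightarrow> r > 0 \<longrightarrow>
       regular_simplex n\<^sub>1 (s - 1) a K \<longrightarrow> regular_simplex n\<^sub>2 (t - 1) b L \<longrightarrow>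
       c \<in> carrier_vec (C * r) \<rightarrow> {..<r} \<longrightarrow>
       (\<exists>P. P \<subseteq> carrier_vec (C * r) \<and> congruent_configs P (cart_prod K L) \<and>
            (rainbow c P \<or> monochromatic c P)))"
proof -
  obtain D :: nat where D: "0 < D"
    "\<And>r (f :: nat \<Rightarrow> nat \<Rightarrow> nat). 0 < r \<Longrightarrow> \<forall>i<D * r. \<forall>j<D * r. f i j < r \<Longrightarrow>
       \<exists>R S. R \<subseteq> {..<D * r} \<and> S \<subseteq> {..<D * r} \<and> card R = s \<and> card S = t \<and>
         (inj_on (\<lambda>(i, j). f i j) (R \<times> S) \<or> (\<exists>k. \<forall>i\<in>R. \<forall>j\<in>S. f i j = k))"
    using rainbow_or_monochromatic_subgrid[OF assms] by blast
  show ?thesis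
  \<comment> \<open>A grid of side \<open>D * r\<close> takes two blocks of \<open>D * r\<close>
    coordinates, hence the factor 2.\<close>
  proof (intro exI[of _ "2 * D"] conjI allI impI)
    show "0 < 2 * D"
      using D(1) by simp
  next
    fix a b :: real and r n\<^sub>1 n\<^sub>2 :: nat and K L :: "real vec set" and c :: "real vec \<Rightarrow> nat"
    assume pos: "a > 0" "b > 0" "r > 0"
      and K: "regular_simplex n\<^sub>1 (s - 1) a K" and L: "regular_simplex n\<^sub>2 (t - 1) b L"
      and c: "c \<in> carrier_vec (2 * D * r) \<rightarrow> {..<r}"
    let ?p = "grid_point a b (D * r)"
    have dim: "?p i j \<in> carrier_vec (2 * D * r)" for i j
      using grid_point_carrier[of a b "D * r" i j] by (simp add: mult_2 add_mult_distrib)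
    then have "c (?p i j) < r" for i j
      using c by (auto dest: funcset_mem)
    then obtain R S where RS: "R \<subseteq> {..<D * r}" "S \<subseteq> {..<D * r}" "card R = s" "card S = t"
      and col: "inj_on (\<lambda>(i, j). c (?p i j)) (R \<times> S) \<or> (\<exists>k. \<forall>i\<in>R. \<forall>j\<in>S. c (?p i j) = k)"
      using D(2)[OF pos(3), of "\<lambda>i j. c (?p i j)"] by blast
    let ?P = "(\<lambda>(i, j). ?p i j) ` (R \<times> S)"
    have "rainbow c ?P \<or> monochromatic c ?P"
      using col
    proof
      assume inj: "inj_on (\<lambda>(i, j). c (?p i j)) (R \<times> S)"
      have "rainbow c ?P"
        unfolding rainbow_def
      proof (clarify)
        fix i j i' j'
        assume "i \<in> R" "j \<in> S" "i' \<in> R" "j' \<in> S" "c (?p i j) = c (?p i' j')"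
          and "?p i j \<noteq> ?p i' j'"
        then show False
          using inj_onD[OF inj, of "(i, j)" "(i', j')"] by simp
      qed
      then show ?thesis ..
    next
      assume "\<exists>k. \<forall>i\<in>R. \<forall>j\<in>S. c (?p i j) = k"
      then have "monochromatic c ?P"
        by (auto simp: monochromatic_def)
      then show ?thesis ..
    qed
    moreover have "?P \<subseteq> carrier_vec (2 * D * r)"
      using dim by auto
    moreover have "congruent_configs ?P (cart_prod K L)"
      by (rule subgrid_congruent_cart_prod[OF K L pos(1,2) assms RS(1,3,2,4)])
    ultimately show "\<exists>P. P \<subseteq> carrier_vec (2 * D * r) \<and> congruent_configs P (cart_prod K L) \<and>
        (rainbow c P \<or> monochromatic c P)"
      by blast
  qed
qed

end
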